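(* Let $\bm{U}=(U_1,\dots,U_d)$ be a random vector that follows an arbitrary copula on $\mathbb{R}^d$, and let $\bm{U}^{(1)},\bm{U}^{(2)},\dots$ be independent copies of $\bm{U}$, with $\bm{U}^{(i)}=(U^{(i)}_1,\dots,U^{(i)}_d)$. Suppose that no pair $U_i,U_j$, $i\ne j$, of the components of $\bm{U}$ satisfies $U_i=U_j$ almost surely. Then $$\lim_{n\to\infty}2^n E\left(\max_{1\le j\le d}\left(|x_j|\prod_{i=1}^n U_j^{(i)}\right)\right)=\sum_{i=1}^d|x_i|,\qquad \bm{x}\in\mathbb{R}^d.$$ In particular, with $\bm{x}=(1,\dots,1)$, $$\lim_{n\to\infty}2^n E\left(\max_{1\le j\le d}\prod_{i=1}^n U_j^{(i)}\right)=d.$$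
   Context: A random vector $\bm{U}=(U_1,\dots,U_d)$ follows a copula on $\mathbb{R}^d$ if each component $U_i$ is uniformly distributed on $(0,1)$ (the joint distribution being otherwise arbitrary). *)

theory Defs
  imports "HOL-Probability.Probability"
begin

definition follows_copula :: "'a measure \<Rightarrow> ('a \<Rightarrow> real ^ 'd) \<Rightarrow> bool" where
  "follows_copula M U \<longleftrightarrow>
     prob_space M \<and> U \<in> borel_measurable M \<and>
     (\<forall>j. distr M borel (\<lambda>\<omega>. U \<omega> $ j) = uniform_measure lborel {0<..<1::real})"

text \<open>The copies \<open>V 1, V 2, \<dots>\<close> of \<open>U\<close> may live on a probability space different from that of \<open>U\<close>;
  \<open>V 0\<close> is unused. Measurability of each copy is part of \<open>indep_vars\<close>.\<close>

definition independent_copies ::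
  "'a measure \<Rightarrow> ('a \<Rightarrow> real ^ 'd) \<Rightarrow> 'b measure \<Rightarrow> (nat \<Rightarrow> 'b \<Rightarrow> real ^ 'd) \<Rightarrow> bool" where
  "independent_copies M U N V \<longleftrightarrow>
     prob_space N \<and> prob_space.indep_vars N (\<lambda>_. borel) V {1..} \<and>
     (\<forall>i\<ge>1. distr N borel (V i) = distr M borel U)"

end

theory Submission
  imports Defs
begin

text \<open>For nonnegative numbers, \<open>\<Sum>\<^sub>i a\<^sub>i - \<Sum>\<^bsub>i\<noteq>j\<^esub> \<surd>(a\<^sub>i a\<^sub>j) \<le> max\<^sub>j a\<^sub>j \<le> \<Sum>\<^sub>i a\<^sub>i\<close>. Take
  \<open>a\<^sub>j = \<bar>x\<^sub>j\<bar> \<Prod>\<^sub>i V\<^sub>i\<^sub>j\<close>. By independence the sums have mean \<open>2\<^sup>-\<^sup>n \<Sum>\<^sub>j \<bar>x\<^sub>j\<bar>\<close>, and the mean of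
  each correction term is a constant times the \<open>n\<close>-th power of \<open>E \<surd>(U\<^sub>i U\<^sub>j)\<close>, which is strictly below
  \<open>1/2\<close> by the arithmetic-geometric mean inequality, since \<open>U\<^sub>i = U\<^sub>j\<close> fails with positive
  probability.\<close>

section \<open>Comparing a finite maximum with a sum\<close>

text \<open>If the maximum is attained at \<open>k\<close>, it misses the full sum by the
  \<open>a j\<close> with \<open>j\<close> other than \<open>k\<close>. Each of these is at most the
  geometric mean of \<open>a j\<close> and the larger \<open>a k\<close>, so row \<open>k\<close> of
  the double sum already pays for the gap; the other rows are nonnegative.\<close>

lemma sum_minus_sqrt_le_Max:
  fixes a :: "'i::finite \<Rightarrow> real"
  assumes "\<And>i. a i \<ge> 0"
  shows "(\<Sum>i\<in>UNIV. a i) - (\<Sum>i\<in>UNIV. \<Sum>j\<in>UNIV - {i}. sqrt (a i * a j)) \<le> (MAX j. a j)"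
proof -
  have "Max (range a) \<in> range a"
    by (intro Max_in) auto
  then obtain k where k: "Max (range a) = a k"
    by (metis rangeE)
  have le: "a j \<le> a k" for j
    using Max_ge[of "range a" "a j"] k by auto
  have "a j \<le> sqrt (a k * a j)" for j
    using le[of j] assms by (intro real_le_rsqrt) (auto simp: power2_eq_square mult_right_mono)
  then have "(\<Sum>j\<in>UNIV - {k}. a j) \<le> (\<Sum>j\<in>UNIV - {k}. sqrt (a k * a j))"
    by (intro sum_mono)
  also have "\<dots> \<le> (\<Sum>i\<in>UNIV. \<Sum>j\<in>UNIV - {i}. sqrt (a i * a j))"
    using assms by (intro member_le_sum[where f = "\<lambda>i. \<Sum>j\<in>UNIV - {i}. sqrt (a i * a j)"])
      (auto intro!: sum_nonneg)
  finally show ?thesis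
    using k by (simp add: sum.remove[of UNIV k a])
qed

lemma Max_le_sum:
  fixes a :: "'i::finite \<Rightarrow> real"
  assumes "\<And>i. a i \<ge> 0"
  shows "(MAX j. a j) \<le> (\<Sum>i\<in>UNIV. a i)"
  using assms by (auto intro!: Max.boundedI member_le_sum)

text \<open>HOL's \<open>sqrt\<close> is an odd function on the reals, hence multiplicative for
  factors of either sign. Identities built on this hold at every sample point, not just almost
  everywhere.\<close>

lemma sqrt_prod: "sqrt (\<Prod>i\<in>A. f i) = (\<Prod>i\<in>A. sqrt (f i))"
  by (induction A rule: infinite_finite_induct) (auto simp: real_sqrt_mult)

section \<open>Means of components and of geometric means of two components\<close>

lemma integral_uniform_01: "(\<integral>x. x \<partial>uniform_measure lborel {0<..<1::real}) = 1/2"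
proof -
  have "(\<integral>x. x \<partial>uniform_measure lborel {0<..<1::real})
      = (\<integral>x. x \<partial>density lborel (\<lambda>x. ennreal (indicator {0<..<1::real} x)))"
    by (simp add: uniform_measure_def ennreal_indicator divide_ennreal_def)
  also have "\<dots> = (\<integral>x. indicator {0<..<1} x *\<^sub>R x \<partial>lborel)"
    by (intro integral_density) auto
  \<comment> \<open>The endpoints are null, so the interval may be closed; this and the exponent 1
    give the shape of \<open>integral_power\<close>.\<close>
  also have "\<dots> = (\<integral>x. x ^ 1 * indicator {0..1} x \<partial>lborel)"
  proof (rule integral_cong_AE)
    show "AE x in lborel. indicator {0<..<1} x *\<^sub>R x = x ^ 1 * indicator {0..1::real} x"
      using AE_lborel_singleton[of 0] AE_lborel_singleton[of 1]
      by eventually_elim (auto simp: indicator_def)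
  qed auto
  also have "\<dots> = 1/2"
    by (subst integral_power) auto
  finally show ?thesis .
qed

lemma follows_copula_props:
  fixes U :: "'a \<Rightarrow> real ^ 'd"
  assumes "follows_copula M U"
  shows follows_copula_AE: "AE \<omega> in M. 0 < U \<omega> $ j \<and> U \<omega> $ j < 1"
    and follows_copula_expectation: "(\<integral>\<omega>. U \<omega> $ j \<partial>M) = 1/2"
proof -
  have nth_meas: "(\<lambda>\<omega>. U \<omega> $ j) \<in> borel_measurable M"
    using assms by (auto simp: follows_copula_def intro: measurable_compose[OF _ borel_measurable_nth])
  have D: "distr M borel (\<lambda>\<omega>. U \<omega> $ j) = uniform_measure lborel {0<..<1::real}"
    using assms by (auto simp: follows_copula_def)
  have "AE x in distr M borel (\<lambda>\<omega>. U \<omega> $ j). 0 < x \<and> x < 1"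
    unfolding D by (intro AE_uniform_measureI) auto
  then show "AE \<omega> in M. 0 < U \<omega> $ j \<and> U \<omega> $ j < 1"
    by (rule AE_distrD[OF nth_meas])
  have "(\<integral>\<omega>. U \<omega> $ j \<partial>M) = (\<integral>x. x \<partial>distr M borel (\<lambda>\<omega>. U \<omega> $ j))"
    by (rule integral_distr[OF nth_meas, symmetric]) simp
  then show "(\<integral>\<omega>. U \<omega> $ j \<partial>M) = 1/2"
    by (simp add: D integral_uniform_01)
qed

lemma follows_copula_integrable:
  fixes U :: "'a \<Rightarrow> real ^ 'd"
  assumes "follows_copula M U"
  shows "integrable M (\<lambda>\<omega>. U \<omega> $ j)"
    and "integrable M (\<lambda>\<omega>. sqrt (U \<omega> $ i * U \<omega> $ j))"
proof -
  interpret prob_space M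
    using assms by (simp add: follows_copula_def)
  have [measurable]: "(\<lambda>\<omega>. U \<omega> $ k) \<in> borel_measurable M" for k
    using assms by (auto simp: follows_copula_def intro: measurable_compose[OF _ borel_measurable_nth])
  have "AE \<omega> in M. norm (U \<omega> $ j) \<le> 1"
    using follows_copula_AE[OF assms, of j] by eventually_elim auto
  then show "integrable M (\<lambda>\<omega>. U \<omega> $ j)"
    by (rule integrable_const_bound) measurable
  have "AE \<omega> in M. norm (sqrt (U \<omega> $ i * U \<omega> $ j)) \<le> 1"
    using follows_copula_AE[OF assms, of j] follows_copula_AE[OF assms, of i]
    by eventually_elim (auto simp: mult_le_one)
  then show "integrable M (\<lambda>\<omega>. sqrt (U \<omega> $ i * U \<omega> $ j))"
    by (rule integrable_const_bound) measurable
qed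

text \<open>The gap \<open>h\<close> between arithmetic and geometric mean is almost everywhere half
  the square of a difference of square roots. Were its mean 0, the roots and hence the components
  would agree almost everywhere, against \<open>neq\<close>. So the mean of \<open>h\<close> is
  positive, while the arithmetic mean has expectation 1/2.\<close>

lemma follows_copula_expectation_sqrt_less:
  fixes U :: "'a \<Rightarrow> real ^ 'd"
  assumes U: "follows_copula M U"
    and neq: "\<not> (AE \<omega> in M. U \<omega> $ i = U \<omega> $ j)"
  shows "(\<integral>\<omega>. sqrt (U \<omega> $ i * U \<omega> $ j) \<partial>M) < 1/2"
proof -
  note int = follows_copula_integrable[OF U]
  define h where "h \<omega> = (U \<omega> $ i + U \<omega> $ j) / 2 - sqrt (U \<omega> $ i * U \<omega> $ j)" for \<omega>
  have inth: "integrable M h"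
    unfolding h_def using int by auto
  have sq: "AE \<omega> in M. h \<omega> = (sqrt (U \<omega> $ i) - sqrt (U \<omega> $ j))\<^sup>2 / 2"
    using follows_copula_AE[OF U, of i] follows_copula_AE[OF U, of j]
    by eventually_elim (auto simp: h_def power2_diff real_sqrt_mult field_simps)
  then have nonneg: "AE \<omega> in M. 0 \<le> h \<omega>"
    by eventually_elim (simp only: zero_le_divide_iff, simp)
  have "integral\<^sup>L M h \<noteq> 0"
  proof
    assume "integral\<^sup>L M h = 0"
    then have "AE \<omega> in M. h \<omega> = 0"
      using integral_nonneg_eq_0_iff_AE[OF inth nonneg] by simp
    then have "AE \<omega> in M. U \<omega> $ i = U \<omega> $ j"
      using sq by eventually_elim auto
    with neq show False ..
  qed
  with integral_nonneg_AE[OF nonneg] have "integral\<^sup>L M h > 0"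
    by simp
  also have "integral\<^sup>L M h = 1/2 - (\<integral>\<omega>. sqrt (U \<omega> $ i * U \<omega> $ j) \<partial>M)"
    unfolding h_def using int follows_copula_expectation[OF U] by simp
  finally show ?thesis
    by simp
qed

section \<open>Products over independent copies\<close>

text \<open>Integrability and mean of \<open>h (V i \<omega>)\<close> depend only on the law of
  \<open>V i\<close>, which is that of \<open>U\<close>; independence then factorizes the mean. A
  general Borel \<open>h\<close> covers both uses: a coordinate, and the geometric mean of two
  coordinates.\<close>

lemma independent_copies_prod:
  fixes U :: "'a \<Rightarrow> real ^ 'd" and h :: "real ^ 'd \<Rightarrow> real"
  assumes copies: "independent_copies M U N V"
    and U [measurable]: "U \<in> borel_measurable M"
    and h [measurable]: "h \<in> borel_measurable borel"
    and int: "integrable M (\<lambda>\<omega>. h (U \<omega>))"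
  shows "integrable N (\<lambda>\<omega>. \<Prod>i=1..n. h (V i \<omega>))"
    and "(\<integral>\<omega>. (\<Prod>i=1..n. h (V i \<omega>)) \<partial>N) = (\<integral>\<omega>. h (U \<omega>) \<partial>M) ^ n"
proof -
  interpret N: prob_space N
    using copies by (simp add: independent_copies_def)
  have V: "N.indep_vars (\<lambda>_. borel) V {1..}"
    and D: "\<And>i. i \<ge> 1 \<Longrightarrow> distr N borel (V i) = distr M borel U"
    using copies by (auto simp: independent_copies_def)
  have meas: "V i \<in> borel_measurable N" if "i \<ge> 1" for i
    using V that by (auto simp: N.indep_vars_def)
  have indep: "N.indep_vars (\<lambda>_. borel) (\<lambda>i \<omega>. h (V i \<omega>)) {1..n}"
    by (rule N.indep_vars_compose2[OF N.indep_vars_subset[OF V]]) auto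
  have intV: "integrable N (\<lambda>\<omega>. h (V i \<omega>))" if "i \<ge> 1" for i
    using int D[OF that] integrable_distr_eq[OF meas[OF that] h] integrable_distr_eq[OF U h] by simp
  have EV: "(\<integral>\<omega>. h (V i \<omega>) \<partial>N) = (\<integral>\<omega>. h (U \<omega>) \<partial>M)" if "i \<ge> 1" for i
    using D[OF that] integral_distr[OF meas[OF that] h] integral_distr[OF U h] by simp
  show "integrable N (\<lambda>\<omega>. \<Prod>i=1..n. h (V i \<omega>))"
    by (rule N.indep_vars_integrable[OF _ indep]) (auto intro: intV)
  show "(\<integral>\<omega>. (\<Prod>i=1..n. h (V i \<omega>)) \<partial>N) = (\<integral>\<omega>. h (U \<omega>) \<partial>M) ^ n"
    by (subst N.indep_vars_lebesgue_integral[OF _ indep]) (auto intro: intV simp: EV)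
qed

text \<open>Nonnegativity passes from \<open>U\<close> to each copy through the common law. There
  are countably many pairs of copy and coordinate, so one null set serves them all, and with them
  every \<open>n\<close>.\<close>

lemma independent_copies_AE_nonneg:
  fixes U :: "'a \<Rightarrow> real ^ 'd"
  assumes copies: "independent_copies M U N V" and U: "follows_copula M U"
  shows "AE \<omega> in N. \<forall>i\<ge>1. \<forall>j. 0 \<le> V i \<omega> $ j"
proof -
  have [measurable]: "U \<in> borel_measurable M"
    using U by (simp add: follows_copula_def)
  interpret N: prob_space N
    using copies by (simp add: independent_copies_def)
  have "AE \<omega> in N. 0 \<le> V i \<omega> $ j" if "i \<ge> 1" for i j
  proof -
    have V: "V i \<in> borel_measurable N" and D: "distr N borel (V i) = distr M borel U"
      using copies that by (auto simp: independent_copies_def N.indep_vars_def)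
    have "AE \<omega> in M. 0 \<le> U \<omega> $ j"
      using follows_copula_AE[OF U, of j] by eventually_elim auto
    then have "AE v in distr N borel (V i). 0 \<le> v $ j"
      unfolding D by (subst AE_distr_iff) auto
    then show ?thesis
      by (rule AE_distrD[OF V])
  qed
  then show ?thesis
    by (simp add: AE_all_countable)
qed

section \<open>The limit by squeezing\<close>

lemma independent_copies_scaled_Max:
  fixes U :: "'a \<Rightarrow> real ^ 'd" and x :: "real ^ 'd"
  assumes U: "follows_copula M U"
    and copies: "independent_copies M U N V"
    and neq: "\<And>i j. i \<noteq> j \<Longrightarrow> \<not> (AE \<omega> in M. U \<omega> $ i = U \<omega> $ j)"
  shows "(\<lambda>n. 2 ^ n * (\<integral>\<omega>. (MAX j. \<bar>x $ j\<bar> * (\<Prod>i=1..n. V i \<omega> $ j)) \<partial>N))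
           \<longlonglongrightarrow> (\<Sum>i\<in>UNIV. \<bar>x $ i\<bar>)"
proof -
  have Um: "U \<in> borel_measurable M"
    using U by (simp add: follows_copula_def)
  define c where "c i j = (\<integral>\<omega>. sqrt (U \<omega> $ i * U \<omega> $ j) \<partial>M)" for i j
  define a where "a n \<omega> j = \<bar>x $ j\<bar> * (\<Prod>i=1..n. V i \<omega> $ j)" for n \<omega> j
  define corr where "corr n \<omega> = (\<Sum>i\<in>UNIV. \<Sum>j\<in>UNIV - {i}. sqrt (a n \<omega> i * a n \<omega> j))" for n \<omega>
  note prod_nth = independent_copies_prod[OF copies Um borel_measurable_nth
      follows_copula_integrable(1)[OF U]]
  have sqrt_meas: "(\<lambda>v. sqrt (v $ i * v $ j)) \<in> borel_measurable borel" for i j :: 'd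
    by measurable
  note prod_sqrt = independent_copies_prod[OF copies Um sqrt_meas
      follows_copula_integrable(2)[OF U]]
  \<comment> \<open>The correction term becomes a constant times a product with one factor per copy,
    which is the form \<open>independent_copies_prod\<close> requires.\<close>
  have sqrt_a: "sqrt (a n \<omega> i * a n \<omega> j)
      = sqrt (\<bar>x $ i\<bar> * \<bar>x $ j\<bar>) * (\<Prod>k=1..n. sqrt (V k \<omega> $ i * V k \<omega> $ j))" for n \<omega> i j
    by (simp add: a_def real_sqrt_mult sqrt_prod prod.distrib)
  have int_a: "integrable N (\<lambda>\<omega>. a n \<omega> j)" for n j
    unfolding a_def by (intro integrable_mult_right prod_nth)
  have int_sqrt: "integrable N (\<lambda>\<omega>. sqrt (a n \<omega> i * a n \<omega> j))" for n i j
    unfolding sqrt_a by (intro integrable_mult_right prod_sqrt)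
  have int_max: "integrable N (\<lambda>\<omega>. MAX j. a n \<omega> j)" for n
    using int_a by (intro integrable_MAX) auto
  have int_corr: "integrable N (corr n)" for n
    unfolding corr_def using int_sqrt by auto
  \<comment> \<open>After scaling, the mean of the sum does not depend on \<open>n\<close>: the
    power of 2 cancels the mean 1/2 of each factor.\<close>
  have E_sum: "2 ^ n * (\<integral>\<omega>. (\<Sum>j\<in>UNIV. a n \<omega> j) \<partial>N) = (\<Sum>j\<in>UNIV. \<bar>x $ j\<bar>)" for n
  proof -
    have "(\<integral>\<omega>. a n \<omega> j \<partial>N) = \<bar>x $ j\<bar> * (1/2) ^ n" for j
      unfolding a_def using prod_nth(2)[of j n] follows_copula_expectation[OF U, of j] by simp
    then have "(\<integral>\<omega>. (\<Sum>j\<in>UNIV. a n \<omega> j) \<partial>N) = (\<Sum>j\<in>UNIV. \<bar>x $ j\<bar>) * (1/2) ^ n"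
      using int_a by (simp add: sum_distrib_right)
    then show ?thesis
      by (simp add: power_divide)
  qed
  \<comment> \<open>The factor \<open>2 ^ n\<close> is absorbed into the \<open>n\<close>-th power,
    so decay is decided by whether \<open>2 * c i j\<close> lies below 1.\<close>
  have E_corr: "2 ^ n * (\<integral>\<omega>. corr n \<omega> \<partial>N)
      = (\<Sum>i\<in>UNIV. \<Sum>j\<in>UNIV - {i}. sqrt (\<bar>x $ i\<bar> * \<bar>x $ j\<bar>) * (2 * c i j) ^ n)" for n
  proof -
    have "(\<integral>\<omega>. sqrt (a n \<omega> i * a n \<omega> j) \<partial>N) = sqrt (\<bar>x $ i\<bar> * \<bar>x $ j\<bar>) * c i j ^ n" for i j
      unfolding sqrt_a c_def using prod_sqrt(2)[of i j n] by simp
    then have "(\<integral>\<omega>. corr n \<omega> \<partial>N)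
        = (\<Sum>i\<in>UNIV. \<Sum>j\<in>UNIV - {i}. sqrt (\<bar>x $ i\<bar> * \<bar>x $ j\<bar>) * c i j ^ n)"
      unfolding corr_def using int_sqrt by simp
    then show ?thesis
      by (simp add: sum_distrib_left power_mult_distrib mult_ac)
  qed
  \<comment> \<open>This is where the assumption on pairs enters: it puts \<open>2 * c i j\<close>
    in the half-open interval from 0 to 1, with 1 excluded.\<close>
  have c_lim: "(\<lambda>n. (2 * c i j) ^ n) \<longlonglongrightarrow> 0" if "i \<noteq> j" for i j
  proof -
    have "AE \<omega> in M. 0 \<le> sqrt (U \<omega> $ i * U \<omega> $ j)"
      using follows_copula_AE[OF U, of i] follows_copula_AE[OF U, of j] by eventually_elim auto
    then have "c i j \<ge> 0"
      unfolding c_def by (rule integral_nonneg_AE)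
    moreover have "c i j < 1/2"
      unfolding c_def using follows_copula_expectation_sqrt_less[OF U neq[OF that]] .
    ultimately show ?thesis
      by (intro LIMSEQ_realpow_zero) auto
  qed
  \<comment> \<open>The inner range omits \<open>i\<close>, so only off-diagonal pairs occur and
    \<open>c_lim\<close> applies to every one of the finitely many terms.\<close>
  have "(\<lambda>n. (\<Sum>i\<in>UNIV. \<Sum>j\<in>UNIV - {i}. sqrt (\<bar>x $ i\<bar> * \<bar>x $ j\<bar>) * (2 * c i j) ^ n))
      \<longlonglongrightarrow> (\<Sum>i\<in>UNIV. \<Sum>j\<in>UNIV - {i}. sqrt (\<bar>x $ i\<bar> * \<bar>x $ j\<bar>) * 0)"
    by (intro tendsto_sum tendsto_mult tendsto_const c_lim) auto
  then have "(\<lambda>n. 2 ^ n * (\<integral>\<omega>. corr n \<omega> \<partial>N)) \<longlonglongrightarrow> 0"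
    by (simp add: E_corr)
  then have "(\<lambda>n. (\<Sum>j\<in>UNIV. \<bar>x $ j\<bar>) - 2 ^ n * (\<integral>\<omega>. corr n \<omega> \<partial>N))
      \<longlonglongrightarrow> (\<Sum>j\<in>UNIV. \<bar>x $ j\<bar>) - 0"
    by (intro tendsto_diff tendsto_const)
  then have lower_lim: "(\<lambda>n. (\<Sum>j\<in>UNIV. \<bar>x $ j\<bar>) - 2 ^ n * (\<integral>\<omega>. corr n \<omega> \<partial>N))
      \<longlonglongrightarrow> (\<Sum>j\<in>UNIV. \<bar>x $ j\<bar>)"
    by simp
  \<comment> \<open>Both elementary bounds on the maximum need nonnegative entries, so they are
    applied off a null set and then integrated.\<close>
  have a_nonneg: "AE \<omega> in N. \<forall>j. 0 \<le> a n \<omega> j" for n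
    using independent_copies_AE_nonneg[OF copies U]
    by eventually_elim (auto simp: a_def intro!: mult_nonneg_nonneg prod_nonneg)
  have upper: "2 ^ n * (\<integral>\<omega>. (MAX j. a n \<omega> j) \<partial>N) \<le> (\<Sum>j\<in>UNIV. \<bar>x $ j\<bar>)" for n
  proof -
    have "AE \<omega> in N. (MAX j. a n \<omega> j) \<le> (\<Sum>j\<in>UNIV. a n \<omega> j)"
      using a_nonneg[of n] by eventually_elim (rule Max_le_sum, blast)
    then have "(\<integral>\<omega>. (MAX j. a n \<omega> j) \<partial>N) \<le> (\<integral>\<omega>. (\<Sum>j\<in>UNIV. a n \<omega> j) \<partial>N)"
      using int_a int_max by (intro integral_mono_AE) auto
    then have "2 ^ n * (\<integral>\<omega>. (MAX j. a n \<omega> j) \<partial>N) \<le> 2 ^ n * (\<integral>\<omega>. (\<Sum>j\<in>UNIV. a n \<omega> j) \<partial>N)"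
      by (intro mult_left_mono) auto
    then show ?thesis
      unfolding E_sum .
  qed
  have lower: "(\<Sum>j\<in>UNIV. \<bar>x $ j\<bar>) - 2 ^ n * (\<integral>\<omega>. corr n \<omega> \<partial>N)
      \<le> 2 ^ n * (\<integral>\<omega>. (MAX j. a n \<omega> j) \<partial>N)" for n
  proof -
    have "AE \<omega> in N. (\<Sum>j\<in>UNIV. a n \<omega> j) - corr n \<omega> \<le> (MAX j. a n \<omega> j)"
      using a_nonneg[of n]
      unfolding corr_def by eventually_elim (rule sum_minus_sqrt_le_Max, blast)
    then have "(\<integral>\<omega>. (\<Sum>j\<in>UNIV. a n \<omega> j) - corr n \<omega> \<partial>N) \<le> (\<integral>\<omega>. (MAX j. a n \<omega> j) \<partial>N)"
      using int_a int_corr int_max by (intro integral_mono_AE) auto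
    also have "(\<integral>\<omega>. (\<Sum>j\<in>UNIV. a n \<omega> j) - corr n \<omega> \<partial>N)
        = (\<integral>\<omega>. (\<Sum>j\<in>UNIV. a n \<omega> j) \<partial>N) - (\<integral>\<omega>. corr n \<omega> \<partial>N)"
      using int_a int_corr by (intro Bochner_Integration.integral_diff) auto
    finally have "2 ^ n * ((\<integral>\<omega>. (\<Sum>j\<in>UNIV. a n \<omega> j) \<partial>N) - (\<integral>\<omega>. corr n \<omega> \<partial>N))
        \<le> 2 ^ n * (\<integral>\<omega>. (MAX j. a n \<omega> j) \<partial>N)"
      by (intro mult_left_mono) auto
    then show ?thesis
      unfolding right_diff_distrib E_sum .
  qed
  \<comment> \<open>The upper bound is constant in \<open>n\<close>, and the lower bound tends to
    the same constant.\<close>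
  have "(\<lambda>n. 2 ^ n * (\<integral>\<omega>. (MAX j. a n \<omega> j) \<partial>N)) \<longlonglongrightarrow> (\<Sum>j\<in>UNIV. \<bar>x $ j\<bar>)"
    by (rule tendsto_sandwich[OF _ _ lower_lim tendsto_const]) (intro always_eventually allI lower upper)+
  then show ?thesis
    by (simp only: a_def)
qed

theorem corollary4p4:
  fixes M :: "'a measure" and U :: "'a \<Rightarrow> real ^ 'd"
    and N :: "'b measure" and V :: "nat \<Rightarrow> 'b \<Rightarrow> real ^ 'd"
  assumes "follows_copula M U"
    and "independent_copies M U N V"
    and "\<And>i j. i \<noteq> j \<Longrightarrow> \<not> (AE \<omega> in M. U \<omega> $ i = U \<omega> $ j)"
  shows "(\<forall>x :: real ^ 'd.
            (\<lambda>n. 2 ^ n * prob_space.expectation N (\<lambda>\<omega>. MAX j. \<bar>x $ j\<bar> * (\<Prod>i=1..n. V i \<omega> $ j)))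
              \<longlonglongrightarrow> (\<Sum>i\<in>UNIV. \<bar>x $ i\<bar>)) \<and>
         (\<lambda>n. 2 ^ n * prob_space.expectation N (\<lambda>\<omega>. MAX j. \<Prod>i=1..n. V i \<omega> $ j))
           \<longlonglongrightarrow> real CARD('d)"
proof
  show "\<forall>x :: real ^ 'd.
            (\<lambda>n. 2 ^ n * prob_space.expectation N (\<lambda>\<omega>. MAX j. \<bar>x $ j\<bar> * (\<Prod>i=1..n. V i \<omega> $ j)))
              \<longlonglongrightarrow> (\<Sum>i\<in>UNIV. \<bar>x $ i\<bar>)"
    using independent_copies_scaled_Max[OF assms] by blast
  \<comment> \<open>With the all-ones vector the weights disappear from the maximum, and their sum
    counts the coordinates.\<close>
  show "(\<lambda>n. 2 ^ n * prob_space.expectation N (\<lambda>\<omega>. MAX j. \<Prod>i=1..n. V i \<omega> $ j))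
           \<longlonglongrightarrow> real CARD('d)"
    using independent_copies_scaled_Max[OF assms, of "\<chi> i. 1"] by simp
qed

end
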